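(* Let $M\colon p\rightsquigarrow q$ be a physical transformation such that its corresponding computational transformation $\mathsf{Q}M\colon\mathsf{Q}(p)\rightsquigarrow\mathsf{Q}(q)$ is deterministic. Then the following are equivalent: 1. $M$ is non-entropy-ejecting; 2. $\mathsf{Q}M$ is conditionally reversible.
   Context: Composition is written in diagrammatic order. A matrix of shape $(X,Y)$, for sets $X,Y$, is a function $M\colon X\times Y\to\mathbb{R}$ with rows $M_{x,-}$. A subdistribution on $X$ is a finitely supported function $p\colon X\to[0,1]$ with $\sum_x p_x\le 1$; it is a distribution if the sum is $1$; $\operatorname{supp}p=\{x: p_x\neq 0\}$. A subdistribution matrix is a matrix whose rows are all subdistributions. Products: $(MN)_{x,z}=\sum_y M_{x,y}N_{y,z}$ and $(pM)_y=\sum_x p_xM_{x,y}$. $\operatorname{supp}M=\{x\in X:\exists y,\ M_{x,y}\ne0\}$. Kronecker product: $(M\otimes N)_{(x,u),(y,v)}=M_{x,y}N_{u,v}$. $\mathbf 1$ is a one-point set. Copy matrix $\Delta_X$ of shape $(X,X\times X)$: entry $1$ at $(x,(x_1,x_2))$ if $x_1=x=x_2$, else $0$. Discard matrix $E_X$ of shape $(X,\mathbf 1)$: all entries $1$. A subdistribution matrix $M$ of shape $(X,Y)$ is deterministic if $\Delta_X(M\otimes M)=M\Delta_Y$. Its domain of definition is $\overline M=\Delta_X(\mathrm{id}_X\otimes(ME_Y))$, of shape $(X,X)$ (identifying $X\times\mathbf 1$ with $X$). A partial inverse of $M$ is a subdistribution matrix $N$ of shape $(Y,X)$ with $MN=\overline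 M$ and $NM=\overline N$. A partitioned set $(X,\sim)$ is a set with an equivalence relation. Subdistributions $p,q$ on $X$ are equivalent, $p\sim q$, if $\sum_{x'\in[x]}p_{x'}=\sum_{x'\in[x]}q_{x'}$ for all $x\in X$. A subdistribution matrix $M$ of shape $(X,Y)$ between partitioned sets is partitioned if $p\sim q$ implies $pM\sim qM$ for all subdistributions $p,q$ on $X$. Aggregation: $\mathsf{Q}M$ is the matrix of shape $(X/{\sim},Y/{\sim})$ with $(\mathsf{Q}M)_{[x],[y]}=\sum_{y'\in[y]}M_{x,y'}$, and for a distribution $p$ on a partitioned set $(X,\sim)$, $\mathsf{Q}(p)_{[x]}=\sum_{x'\in[x]}p_{x'}$. Entropy: $\mathsf H(p)=-\sum_x p_x\log p_x$ with $0\log 0=0$. A physical context is a distribution on a partitioned set; a physical transformation $M\colon p\rightsquigarrow q$ between physical contexts is a partitioned subdistribution matrix with $pM=q$ and $\mathsf H(p)=\mathsf H(q)$. A computational context is a distribution on a set; a computational transformation $M\colon p\rightsquigarrow q$ is a subdistribution matrix with $pM=q$. For a physical context $p$: $\mathsf H_{\mathrm{phy}}(p)=\mathsf H(p)$, $\mathsf H_{\mathrm{comp}}(p)=\mathsf H(\mathsf{Q}(p))$, $\mathsf H_{\mathrm{nc}}(p)=\mathsf H_{\mathrm{phy}}(p)-\mathsf H_{\mathrm{comp}}(p)$. A physical transformation $M\colon p\rightsquigarrow q$ is non-entropy-ejecting if $\mathsf H_{\mathrm{nc}}(q)\le\mathsf H_{\mathrm{nc}}(p)$. A deterministic computational transformation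 $M\colon p\rightsquigarrow q$, with $M$ of shape $(X,Y)$, is conditionally reversible if $\operatorname{supp}p\subseteq\operatorname{supp}M$ and the matrix $M|_p$ of shape $(\operatorname{supp}p,Y)$, $(x,y)\mapsto M_{x,y}$, has a partial inverse. *)

theory Defs
  imports Complex_Main
begin

text \<open>
  Sets are explicit carriers. A matrix of shape \<open>(X, Y)\<close> is a function
  \<open>'a \<Rightarrow> 'b \<Rightarrow> real\<close> of which only the values on \<open>X \<times> Y\<close> are ever used; hence
  restricting a matrix to a subset of its rows only changes the carrier, and equality of
  matrices is equality on the carriers. Since carriers may be infinite, sums of finitely
  supported functions are taken with \<open>sum'\<close>.
\<close>

definition supp :: "'a set \<Rightarrow> ('a \<Rightarrow> real) \<Rightarrow> 'a set" where
  "supp X p = {x \<in> X. p x \<noteq> 0}"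

definition subdistribution :: "'a set \<Rightarrow> ('a \<Rightarrow> real) \<Rightarrow> bool" where
  "subdistribution X p \<longleftrightarrow>
     finite (supp X p) \<and> (\<forall>x\<in>X. 0 \<le> p x \<and> p x \<le> 1) \<and> sum' p X \<le> 1"

definition distribution :: "'a set \<Rightarrow> ('a \<Rightarrow> real) \<Rightarrow> bool" where
  "distribution X p \<longleftrightarrow> subdistribution X p \<and> sum' p X = 1"

definition subdist_matrix :: "'a set \<Rightarrow> 'b set \<Rightarrow> ('a \<Rightarrow> 'b \<Rightarrow> real) \<Rightarrow> bool" where
  "subdist_matrix X Y M \<longleftrightarrow> (\<forall>x\<in>X. subdistribution Y (M x))"

definition mat_eq ::
  "'a set \<Rightarrow> 'b set \<Rightarrow> ('a \<Rightarrow> 'b \<Rightarrow> real) \<Rightarrow> ('a \<Rightarrow> 'b \<Rightarrow> real) \<Rightarrow> bool" where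
  "mat_eq X Y M N \<longleftrightarrow> (\<forall>x\<in>X. \<forall>y\<in>Y. M x y = N x y)"

definition mat_mult ::
  "'b set \<Rightarrow> ('a \<Rightarrow> 'b \<Rightarrow> real) \<Rightarrow> ('b \<Rightarrow> 'c \<Rightarrow> real) \<Rightarrow> 'a \<Rightarrow> 'c \<Rightarrow> real" where
  "mat_mult Y M N x z = sum' (\<lambda>y. M x y * N y z) Y"

definition vec_mult :: "'a set \<Rightarrow> ('a \<Rightarrow> real) \<Rightarrow> ('a \<Rightarrow> 'b \<Rightarrow> real) \<Rightarrow> 'b \<Rightarrow> real" where
  "vec_mult X p M y = sum' (\<lambda>x. p x * M x y) X"

definition mat_supp :: "'a set \<Rightarrow> 'b set \<Rightarrow> ('a \<Rightarrow> 'b \<Rightarrow> real) \<Rightarrow> 'a set" where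
  "mat_supp X Y M = {x \<in> X. \<exists>y\<in>Y. M x y \<noteq> 0}"

definition kronecker ::
  "('a \<Rightarrow> 'b \<Rightarrow> real) \<Rightarrow> ('c \<Rightarrow> 'd \<Rightarrow> real) \<Rightarrow> 'a \<times> 'c \<Rightarrow> 'b \<times> 'd \<Rightarrow> real" where
  "kronecker M N = (\<lambda>(x, u) (y, v). M x y * N u v)"

definition id_mat :: "'a \<Rightarrow> 'a \<Rightarrow> real" where
  "id_mat x y = (if x = y then 1 else 0)"

definition copy_mat :: "'a \<Rightarrow> 'a \<times> 'a \<Rightarrow> real" where
  "copy_mat x = (\<lambda>(x1, x2). if x1 = x \<and> x = x2 then 1 else 0)"

definition discard_mat :: "'a \<Rightarrow> unit \<Rightarrow> real" where
  "discard_mat x u = 1"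

definition deterministic :: "'a set \<Rightarrow> 'b set \<Rightarrow> ('a \<Rightarrow> 'b \<Rightarrow> real) \<Rightarrow> bool" where
  "deterministic X Y M \<longleftrightarrow> subdist_matrix X Y M \<and>
     mat_eq X (Y \<times> Y) (mat_mult (X \<times> X) copy_mat (kronecker M M)) (mat_mult Y M copy_mat)"

text \<open>The column index \<open>(x', ())\<close> realises the identification of \<open>X \<times> 1\<close> with \<open>X\<close>.\<close>

definition dom_of_def ::
  "'a set \<Rightarrow> 'b set \<Rightarrow> ('a \<Rightarrow> 'b \<Rightarrow> real) \<Rightarrow> 'a \<Rightarrow> 'a \<Rightarrow> real" where
  "dom_of_def X Y M x x' =
     mat_mult (X \<times> X) copy_mat (kronecker id_mat (mat_mult Y M discard_mat)) x (x', ())"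

definition partial_inverse ::
  "'a set \<Rightarrow> 'b set \<Rightarrow> ('a \<Rightarrow> 'b \<Rightarrow> real) \<Rightarrow> ('b \<Rightarrow> 'a \<Rightarrow> real) \<Rightarrow> bool" where
  "partial_inverse X Y M N \<longleftrightarrow> subdist_matrix Y X N \<and>
     mat_eq X X (mat_mult Y M N) (dom_of_def X Y M) \<and>
     mat_eq Y Y (mat_mult X N M) (dom_of_def Y X N)"

definition subdist_equiv ::
  "'a set \<Rightarrow> ('a \<times> 'a) set \<Rightarrow> ('a \<Rightarrow> real) \<Rightarrow> ('a \<Rightarrow> real) \<Rightarrow> bool" where
  "subdist_equiv X r p q \<longleftrightarrow> (\<forall>x\<in>X. sum' p (r `` {x}) = sum' q (r `` {x}))"

definition partitioned_matrix ::
  "'a set \<Rightarrow> ('a \<times> 'a) set \<Rightarrow> 'b set \<Rightarrow> ('b \<times> 'b) set \<Rightarrow> ('a \<Rightarrow> 'b \<Rightarrow> real) \<Rightarrow> bool" where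
  "partitioned_matrix X r Y s M \<longleftrightarrow> subdist_matrix X Y M \<and>
     (\<forall>p q. subdistribution X p \<longrightarrow> subdistribution X q \<longrightarrow> subdist_equiv X r p q \<longrightarrow>
        subdist_equiv Y s (vec_mult X p M) (vec_mult X q M))"

text \<open>
  Aggregation is indexed by equivalence classes, i.e. by elements of \<open>X // r\<close> and \<open>Y // s\<close>.
  The entry of an aggregated matrix is computed from an arbitrary representative of the row
  class; by \<open>quot_mat_class\<close> below, the choice is immaterial if the matrix is partitioned.
\<close>

definition quot_mat :: "('a \<Rightarrow> 'b \<Rightarrow> real) \<Rightarrow> 'a set \<Rightarrow> 'b set \<Rightarrow> real" where
  "quot_mat M A B = sum' (M (SOME x. x \<in> A)) B"

definition quot_dist :: "('a \<Rightarrow> real) \<Rightarrow> 'a set \<Rightarrow> real" where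
  "quot_dist p A = sum' p A"

text \<open>The convention \<open>0 log 0 = 0\<close> holds automatically. The base of the logarithm is \<open>e\<close>;
  another base greater than 1 would rescale all entropies by a common positive factor.\<close>

definition entropy :: "'a set \<Rightarrow> ('a \<Rightarrow> real) \<Rightarrow> real" where
  "entropy X p = - sum' (\<lambda>x. p x * ln (p x)) X"

definition physical_context :: "'a set \<Rightarrow> ('a \<times> 'a) set \<Rightarrow> ('a \<Rightarrow> real) \<Rightarrow> bool" where
  "physical_context X r p \<longleftrightarrow> equiv X r \<and> distribution X p"

definition physical_transformation ::
  "'a set \<Rightarrow> ('a \<times> 'a) set \<Rightarrow> ('a \<Rightarrow> real) \<Rightarrow> 'b set \<Rightarrow> ('b \<times> 'b) set \<Rightarrow> ('b \<Rightarrow> real) \<Rightarrow>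
   ('a \<Rightarrow> 'b \<Rightarrow> real) \<Rightarrow> bool" where
  "physical_transformation X r p Y s q M \<longleftrightarrow>
     physical_context X r p \<and> physical_context Y s q \<and> partitioned_matrix X r Y s M \<and>
     (\<forall>y\<in>Y. vec_mult X p M y = q y) \<and> entropy X p = entropy Y q"

definition computational_transformation ::
  "'a set \<Rightarrow> ('a \<Rightarrow> real) \<Rightarrow> 'b set \<Rightarrow> ('b \<Rightarrow> real) \<Rightarrow> ('a \<Rightarrow> 'b \<Rightarrow> real) \<Rightarrow> bool" where
  "computational_transformation X p Y q M \<longleftrightarrow>
     distribution X p \<and> distribution Y q \<and> subdist_matrix X Y M \<and>
     (\<forall>y\<in>Y. vec_mult X p M y = q y)"

definition H_phy :: "'a set \<Rightarrow> ('a \<Rightarrow> real) \<Rightarrow> real" where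
  "H_phy X p = entropy X p"

definition H_comp :: "'a set \<Rightarrow> ('a \<times> 'a) set \<Rightarrow> ('a \<Rightarrow> real) \<Rightarrow> real" where
  "H_comp X r p = entropy (X // r) (quot_dist p)"

definition H_nc :: "'a set \<Rightarrow> ('a \<times> 'a) set \<Rightarrow> ('a \<Rightarrow> real) \<Rightarrow> real" where
  "H_nc X r p = H_phy X p - H_comp X r p"

definition non_entropy_ejecting ::
  "'a set \<Rightarrow> ('a \<times> 'a) set \<Rightarrow> ('a \<Rightarrow> real) \<Rightarrow> 'b set \<Rightarrow> ('b \<times> 'b) set \<Rightarrow> ('b \<Rightarrow> real) \<Rightarrow>
   ('a \<Rightarrow> 'b \<Rightarrow> real) \<Rightarrow> bool" where
  "non_entropy_ejecting X r p Y s q M \<longleftrightarrow>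
     physical_transformation X r p Y s q M \<and> H_nc Y s q \<le> H_nc X r p"

definition conditionally_reversible ::
  "'a set \<Rightarrow> ('a \<Rightarrow> real) \<Rightarrow> 'b set \<Rightarrow> ('b \<Rightarrow> real) \<Rightarrow> ('a \<Rightarrow> 'b \<Rightarrow> real) \<Rightarrow> bool" where
  "conditionally_reversible X p Y q M \<longleftrightarrow>
     computational_transformation X p Y q M \<and> deterministic X Y M \<and>
     supp X p \<subseteq> mat_supp X Y M \<and> (\<exists>N. partial_inverse (supp X p) Y M N)"


lemma sum'_eq_sum:
  fixes f :: "'a \<Rightarrow> real"
  assumes "finite S" "S \<subseteq> X" "\<And>x. x \<in> X \<Longrightarrow> f x \<noteq> 0 \<Longrightarrow> x \<in> S"
  shows "sum' f X = sum f S"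
proof -
  have "sum' f S = sum' f X"
    using assms by (intro sum.mono_neutral_left') auto
  then show ?thesis using assms(1) by simp
qed

lemma sum'_supp:
  fixes f :: "'a \<Rightarrow> real"
  assumes "finite (supp X f)" "A \<subseteq> X"
  shows "sum' f A = sum f (supp X f \<inter> A)"
  using assms by (intro sum'_eq_sum) (auto simp: supp_def)

lemma quot_mat_class:
  assumes M: "partitioned_matrix X r Y s M" and r: "equiv X r" and x: "x \<in> X"
    and B: "B \<in> Y // s"
  shows "quot_mat M (r `` {x}) B = sum' (M x) B"
proof -
  define x' where "x' = (SOME x'. x' \<in> r `` {x})"
  have "x \<in> r `` {x}" using r x by (rule equiv_class_self)
  then have "x' \<in> r `` {x}" unfolding x'_def by (rule someI)
  then have rx: "(x, x') \<in> r" by simp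
  then have x': "x' \<in> X" using r by (auto simp: equiv_def)
  let ?d = "\<lambda>(a::'a) z. if z = a then 1 else 0 :: real"
  have sub: "subdistribution X (?d a)" if "a \<in> X" for a
  proof -
    have "sum' (?d a) X = sum (?d a) {a}"
      using that by (intro sum'_eq_sum) (auto split: if_splits)
    moreover have "supp X (?d a) \<subseteq> {a}" by (auto simp: supp_def split: if_splits)
    then have "finite (supp X (?d a))" by (rule finite_subset) simp
    ultimately show ?thesis unfolding subdistribution_def by simp
  qed
  have vm: "vec_mult X (?d a) M = M a" if "a \<in> X" for a
  proof
    fix y
    have "sum' (\<lambda>x. ?d a x * M x y) X = sum (\<lambda>x. ?d a x * M x y) {a}"
      using that by (intro sum'_eq_sum) (auto split: if_splits)
    then show "vec_mult X (?d a) M y = M a y" by (simp add: vec_mult_def)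
  qed
  have cls: "sum' (?d a) (r `` {z}) = (if (z, a) \<in> r then 1 else 0)" for a z
  proof -
    have "sum' (?d a) (r `` {z}) = sum (?d a) (if (z, a) \<in> r then {a} else {})"
      by (intro sum'_eq_sum) (auto split: if_splits)
    then show ?thesis by simp
  qed
  have "(z, x) \<in> r \<longleftrightarrow> (z, x') \<in> r" for z
    using rx r by (meson equivE symE transE)
  then have "subdist_equiv X r (?d x') (?d x)"
    by (simp add: subdist_equiv_def cls)
  then have "subdist_equiv Y s (M x') (M x)"
    using M sub[OF x] sub[OF x'] vm[OF x] vm[OF x'] unfolding partitioned_matrix_def by metis
  moreover obtain y where "y \<in> Y" "B = s `` {y}" using B by (auto elim: quotientE)
  ultimately show ?thesis by (simp add: subdist_equiv_def quot_mat_def x'_def)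
qed

lemma finite_supp_quot:
  fixes p :: "'a \<Rightarrow> real"
  assumes r: "equiv X r" and fin: "finite (supp X p)"
  shows "supp (X // r) (\<lambda>A. sum' p A * g A) \<subseteq> (\<lambda>x. r `` {x}) ` supp X p"
proof
  fix A assume "A \<in> supp (X // r) (\<lambda>A. sum' p A * g A)"
  then have A: "A \<in> X // r" and nz: "sum' p A \<noteq> 0" by (auto simp: supp_def)
  have AX: "A \<subseteq> X" using A r in_quotient_imp_subset by fastforce
  have "sum p (supp X p \<inter> A) \<noteq> 0" using nz sum'_supp[OF fin AX] by simp
  then obtain x where x: "x \<in> supp X p" "x \<in> A" by (metis sum.neutral zero_neq_one IntE)
  then have "A = r `` {x}" using A r
    by (metis equiv_class_eq_iff in_quotient_imp_in_rel quotientE Image_singleton_iff equiv_class_eq)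
  then show "A \<in> (\<lambda>x. r `` {x}) ` supp X p" using x by blast
qed

lemma sum'_quot:
  fixes p :: "'a \<Rightarrow> real"
  assumes r: "equiv X r" and fin: "finite (supp X p)"
  shows "sum' (\<lambda>A. sum' p A * g A) (X // r) = sum' (\<lambda>x. p x * g (r `` {x})) X"
proof -
  let ?S = "supp X p" and ?h = "\<lambda>x. r `` {x}"
  have SX: "?S \<subseteq> X" by (auto simp: supp_def)
  have "sum' (\<lambda>A. sum' p A * g A) (X // r) = sum (\<lambda>A. sum' p A * g A) (?h ` ?S)"
    using fin SX finite_supp_quot[OF r fin, of g]
    by (intro sum'_eq_sum) (auto simp: supp_def quotient_def)
  also have "\<dots> = (\<Sum>A\<in>?h ` ?S. \<Sum>x\<in>{x\<in>?S. ?h x = A}. p x * g (?h x))"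
  proof (rule sum.cong[OF refl])
    fix A assume "A \<in> ?h ` ?S"
    then obtain z where z: "z \<in> X" "A = ?h z" using SX by auto
    then have AX: "A \<subseteq> X" using r by (auto simp: equiv_def)
    have "?S \<inter> A = {x\<in>?S. ?h x = A}"
      using z SX r eq_equiv_class_iff[OF r] by (auto simp: equiv_class_eq_iff[OF r])
    then show "sum' p A * g A = (\<Sum>x\<in>{x\<in>?S. ?h x = A}. p x * g (?h x))"
      using sum'_supp[OF fin AX] by (simp add: sum_distrib_right)
  qed
  also have "\<dots> = (\<Sum>x\<in>?S. p x * g (?h x))"
    using sum.image_gen[OF fin, of "\<lambda>x. p x * g (?h x)" ?h] by simp
  also have "\<dots> = sum' (\<lambda>x. p x * g (?h x)) X"
    using fin SX by (intro sum'_eq_sum[symmetric]) (auto simp: supp_def)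
  finally show ?thesis .
qed

lemma subdistribution_quot:
  assumes r: "equiv X r" and p: "subdistribution X p"
  shows "subdistribution (X // r) (sum' p)" and "sum' (sum' p) (X // r) = sum' p X"
proof -
  have fin: "finite (supp X p)" and nn: "\<And>x. x \<in> X \<Longrightarrow> 0 \<le> p x" and le: "sum' p X \<le> 1"
    using p by (auto simp: subdistribution_def)
  show eq: "sum' (sum' p) (X // r) = sum' p X"
    using sum'_quot[OF r fin, of "\<lambda>_. 1"] by simp
  have "finite (supp (X // r) (sum' p))"
    using finite_subset[OF finite_supp_quot[OF r fin, of "\<lambda>_. 1"]] fin by simp
  moreover have "0 \<le> sum' p A \<and> sum' p A \<le> 1" if "A \<in> X // r" for A
  proof -
    have AX: "A \<subseteq> X" using that r in_quotient_imp_subset by fastforce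
    have "sum p (supp X p \<inter> A) \<le> sum p (supp X p \<inter> X)"
      using fin nn by (intro sum_mono2) (auto simp: supp_def)
    moreover have "0 \<le> sum p (supp X p \<inter> A)" using nn by (intro sum_nonneg) (auto simp: supp_def)
    ultimately show ?thesis
      using le sum'_supp[OF fin AX] sum'_supp[OF fin subset_refl] by simp
  qed
  ultimately show "subdistribution (X // r) (sum' p)"
    using eq le by (simp add: subdistribution_def)
qed

lemma computational_transformation_quot:
  assumes "physical_transformation X r p Y s q M"
  shows "computational_transformation (X // r) (quot_dist p) (Y // s) (quot_dist q) (quot_mat M)"
proof -
  have r: "equiv X r" and s: "equiv Y s" and p: "distribution X p" and q: "distribution Y q"
    and M: "partitioned_matrix X r Y s M" and pM: "\<And>y. y \<in> Y \<Longrightarrow> vec_mult X p M y = q y"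
    using assms by (auto simp: physical_transformation_def physical_context_def)
  have Mx: "subdistribution Y (M x)" if "x \<in> X" for x
    using M that by (auto simp: partitioned_matrix_def subdist_matrix_def)
  have dq: "quot_dist f = sum' f" for f :: "'x \<Rightarrow> real" by (auto simp: quot_dist_def)
  have "distribution (X // r) (quot_dist p)" "distribution (Y // s) (quot_dist q)"
    using subdistribution_quot[OF r] subdistribution_quot[OF s] p q
    by (auto simp: distribution_def dq)
  moreover have "subdist_matrix (X // r) (Y // s) (quot_mat M)"
    unfolding subdist_matrix_def quot_mat_def
  proof
    fix A assume "A \<in> X // r"
    then obtain x where x: "x \<in> X" "A = r `` {x}" by (auto elim: quotientE)
    then have "x \<in> A" using equiv_class_self[OF r] by simp
    then have "(SOME x. x \<in> A) \<in> A" by (rule someI)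
    then have "(SOME x. x \<in> A) \<in> X" using x r by (auto simp: equiv_def)
    then show "subdistribution (Y // s) (sum' (M (SOME x. x \<in> A)))"
      using Mx subdistribution_quot(1)[OF s] by blast
  qed
  moreover have "vec_mult (X // r) (quot_dist p) (quot_mat M) B = quot_dist q B"
    if B: "B \<in> Y // s" for B
  proof -
    let ?S = "supp X p"
    define U where "U = (\<Union>x\<in>?S. supp Y (M x)) \<inter> B"
    have BY: "B \<subseteq> Y" using B s in_quotient_imp_subset by fastforce
    have SX: "?S \<subseteq> X" by (auto simp: supp_def)
    have fin: "finite ?S" using p by (auto simp: distribution_def subdistribution_def)
    have finU: "finite U" unfolding U_def using fin SX Mx by (auto simp: subdistribution_def)
    have vm: "vec_mult X p M y = (\<Sum>x\<in>?S. p x * M x y)" for y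
      unfolding vec_mult_def using fin SX by (intro sum'_eq_sum) (auto simp: supp_def)
    have "vec_mult (X // r) (quot_dist p) (quot_mat M) B
        = sum' (\<lambda>x. p x * quot_mat M (r `` {x}) B) X"
      unfolding vec_mult_def quot_dist_def using sum'_quot[OF r fin, of "\<lambda>A. quot_mat M A B"] .
    also have "\<dots> = (\<Sum>x\<in>?S. p x * quot_mat M (r `` {x}) B)"
      using fin SX by (intro sum'_eq_sum) (auto simp: supp_def)
    also have "\<dots> = (\<Sum>x\<in>?S. p x * (\<Sum>y\<in>U. M x y))"
    proof (rule sum.cong[OF refl])
      fix x assume x: "x \<in> ?S"
      then have "sum' (M x) B = sum (M x) U"
        using finU BY by (intro sum'_eq_sum) (auto simp: U_def supp_def)
      then show "p x * quot_mat M (r `` {x}) B = p x * (\<Sum>y\<in>U. M x y)"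
        using quot_mat_class[OF M r _ B] x SX by auto
    qed
    also have "\<dots> = (\<Sum>y\<in>U. \<Sum>x\<in>?S. p x * M x y)"
      by (simp add: sum_distrib_left) (rule sum.swap)
    also have "\<dots> = sum q U" using pM BY by (intro sum.cong) (auto simp: vm U_def)
    also have "\<dots> = sum' q B"
    proof (rule sum'_eq_sum[symmetric])
      fix y assume y: "y \<in> B" "q y \<noteq> 0"
      then have "(\<Sum>x\<in>?S. p x * M x y) \<noteq> 0" using pM vm BY by (metis subsetD)
      then obtain x where "x \<in> ?S" "p x * M x y \<noteq> 0" by (meson sum.neutral)
      then show "y \<in> U" using y BY by (auto simp: U_def supp_def)
    qed (use finU in \<open>auto simp: U_def\<close>)
    finally show ?thesis by (simp add: quot_dist_def)
  qed
  ultimately show ?thesis by (simp add: computational_transformation_def)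
qed

end

theory Submission
  imports Defs
begin

text \<open>
  A physical transformation preserves the physical entropy, so it is non-entropy-ejecting iff
  its aggregation \<open>K: P \<leadsto> Q\<close> does not decrease entropy. As \<open>K\<close> is deterministic and \<open>Q\<close> has
  total mass 1, \<open>K\<close> is on \<open>supp P\<close> the graph of a function \<open>f\<close>, and \<open>Q\<close> is the push-forward of
  \<open>P\<close> along \<open>f\<close>. Then \<open>H(P) - H(Q)\<close> is the sum of the nonnegative terms
  \<open>P x (ln (Q (f x)) - ln (P x))\<close>, so \<open>H(P) \<le> H(Q)\<close> iff \<open>Q (f x) = P x\<close> on \<open>supp P\<close>, that is, iff
  \<open>f\<close> is injective there. Injectivity of \<open>f\<close> in turn means that the restricted matrix has a
  partial inverse, namely its transpose.
\<close>

lemma sum'_singleton: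
  fixes g :: "'a \<Rightarrow> real"
  assumes "a \<in> X" "\<And>x. x \<in> X \<Longrightarrow> x \<noteq> a \<Longrightarrow> g x = 0"
  shows "sum' g X = g a"
proof -
  have "sum' g X = sum g {a}" using assms by (intro sum'_eq_sum) auto
  then show ?thesis by simp
qed

lemma copy_mat_mult:
  assumes "x \<in> X"
  shows "mat_mult (X \<times> X) copy_mat L x c = L (x, x) c"
  unfolding mat_mult_def
  by (subst sum'_singleton[of "(x, x)"]) (use assms in \<open>auto simp: copy_mat_def split: if_splits\<close>)

lemma mult_copy_mat:
  assumes "y \<in> Y"
  shows "mat_mult Y M copy_mat x (y, y') = (if y = y' then M x y else 0)"
  unfolding mat_mult_def
  by (subst sum'_singleton[of y]) (use assms in \<open>auto simp: copy_mat_def split: if_splits\<close>)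

lemma dom_of_def_eq:
  assumes "x \<in> X"
  shows "dom_of_def X Y M x x' = (if x = x' then sum' (M x) Y else 0)"
  unfolding dom_of_def_def copy_mat_mult[OF assms]
  by (simp add: kronecker_def id_mat_def mat_mult_def discard_mat_def)

text \<open>Compare both sides of the determinism equation in column \<open>(y, y')\<close>. The
  diagonal makes every entry idempotent, hence 0 or 1; off the diagonal, a row cannot have two
  nonzero entries.\<close>

lemma deterministic_entries:
  assumes "deterministic X Y M" "x \<in> X" "y \<in> Y" "y' \<in> Y"
  shows "M x y * M x y' = (if y = y' then M x y else 0)"
  using assms by (simp add: deterministic_def mat_eq_def copy_mat_mult mult_copy_mat kronecker_def)

lemma deterministic_graph:
  assumes det: "deterministic X Y M"
  obtains f where
    "\<And>x. x \<in> mat_supp X Y M \<Longrightarrow> f x \<in> Y"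
    "\<And>x y. x \<in> mat_supp X Y M \<Longrightarrow> y \<in> Y \<Longrightarrow> M x y = of_bool (y = f x)"
proof
  let ?f = "\<lambda>x. SOME y. y \<in> Y \<and> M x y \<noteq> 0"
  have f: "?f x \<in> Y \<and> M x (?f x) \<noteq> 0" if "x \<in> mat_supp X Y M" for x
    using that by (intro someI_ex[where P = "\<lambda>y. y \<in> Y \<and> M x y \<noteq> 0"]) (auto simp: mat_supp_def)
  show "?f x \<in> Y" if "x \<in> mat_supp X Y M" for x using f[OF that] by blast
  show "M x y = of_bool (y = ?f x)" if x: "x \<in> mat_supp X Y M" and y: "y \<in> Y" for x y
  proof -
    have "x \<in> X" using x by (simp add: mat_supp_def)
    then have "M x (?f x) * M x y = (if ?f x = y then M x (?f x) else 0)"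
      using deterministic_entries[OF det] f[OF x] y by blast
    \<comment> \<open>Cancel the nonzero factor \<open>M x (?f x)\<close>: the entry is 1 if
      \<open>y = ?f x\<close> and 0 otherwise.\<close>
    then show ?thesis using f[OF x] by (auto split: if_splits)
  qed
qed

lemma distribution_pos:
  assumes "distribution X p" "x \<in> supp X p"
  shows "p x > 0"
  using assms by (force simp: distribution_def subdistribution_def supp_def)

text \<open>A zero row of \<open>K\<close> loses the mass that \<open>p\<close> puts on it. Since
  \<open>p\<close> and \<open>q\<close> both have mass 1, nothing is lost, so \<open>f\<close> is
  defined on the whole support of \<open>p\<close>.\<close>

lemma deterministic_transformation_graph:
  assumes K: "computational_transformation X p Y q K" and det: "deterministic X Y K"
  obtains f where "f ` supp X p \<subseteq> Y"
    "\<forall>x\<in>supp X p. \<forall>y\<in>Y. K x y = of_bool (y = f x)"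
    "\<forall>y\<in>Y. q y = sum p {x \<in> supp X p. f x = y}"
proof -
  obtain f where fY: "\<And>x. x \<in> mat_supp X Y K \<Longrightarrow> f x \<in> Y"
    and fK: "\<And>x y. x \<in> mat_supp X Y K \<Longrightarrow> y \<in> Y \<Longrightarrow> K x y = of_bool (y = f x)"
    using deterministic_graph[OF det] by blast
  \<comment> \<open>\<open>?T\<close> collects the support points with a nonzero row; the
    push-forward formula is first shown over \<open>?T\<close>, before \<open>?T = ?S\<close> is
    known.\<close>
  let ?S = "supp X p" and ?T = "supp X p \<inter> mat_supp X Y K"
  have p: "distribution X p" and q: "distribution Y q"
    and pK: "\<And>y. y \<in> Y \<Longrightarrow> vec_mult X p K y = q y"
    using K by (auto simp: computational_transformation_def)
  have fin: "finite ?S" using p by (simp add: distribution_def subdistribution_def)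
  have qT: "q y = sum p {x \<in> ?T. f x = y}" if y: "y \<in> Y" for y
  proof -
    have "q y = (\<Sum>x\<in>{x \<in> ?T. f x = y}. p x * K x y)"
      unfolding pK[OF y, symmetric] vec_mult_def
    proof (rule sum'_eq_sum)
      fix x assume "x \<in> X" "p x * K x y \<noteq> 0"
      then have x: "x \<in> ?T" and nz: "K x y \<noteq> 0" using y by (auto simp: supp_def mat_supp_def)
      then show "x \<in> {x \<in> ?T. f x = y}" using fK[of x y] y by (auto split: if_splits)
    next
      show "{x \<in> ?T. f x = y} \<subseteq> X" by (auto simp: supp_def)
    qed (use fin in simp)
    also have "\<dots> = sum p {x \<in> ?T. f x = y}"
      using fK y by (intro sum.cong) auto
    finally show ?thesis .
  qed
  \<comment> \<open>Count the total mass twice: directly over \<open>?S\<close>, and through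
    \<open>q\<close> fibre by fibre over \<open>?T\<close>.\<close>
  have "sum p ?S = sum' p X"
    using fin by (intro sum'_eq_sum[symmetric]) (auto simp: supp_def)
  also have "\<dots> = sum' q Y" using p q by (simp add: distribution_def)
  also have "\<dots> = sum q (f ` ?T)"
  proof (rule sum'_eq_sum)
    fix y assume "y \<in> Y" "q y \<noteq> 0"
    then have "{x \<in> ?T. f x = y} \<noteq> {}" using qT by (metis sum.empty)
    then show "y \<in> f ` ?T" by blast
  qed (use fin fY in auto)
  also have "\<dots> = (\<Sum>y\<in>f ` ?T. sum p {x \<in> ?T. f x = y})"
    using fY qT by (intro sum.cong) auto
  also have "\<dots> = sum p ?T" using fin by (intro sum.image_gen[symmetric]) auto
  finally have "sum p (?S - ?T) = 0" using fin by (simp add: sum_diff)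
  then have "\<forall>x\<in>?S - ?T. p x = 0"
    using fin distribution_pos[OF p] by (subst (asm) sum_nonneg_eq_0_iff) (auto intro: less_imp_le)
  then have sub: "?S \<subseteq> mat_supp X Y K" by (auto simp: supp_def)
  then have TS: "?T = ?S" by blast
  show thesis
  proof (rule that)
    show "f ` ?S \<subseteq> Y" using sub fY by blast
    show "\<forall>x\<in>?S. \<forall>y\<in>Y. K x y = of_bool (y = f x)"
      using sub by (intro ballI fK) auto
    show "\<forall>y\<in>Y. q y = sum p {x \<in> ?S. f x = y}"
      using qT unfolding TS by (rule ballI)
  qed
qed

text \<open>The drop \<open>entropy X p - entropy Y q\<close> is the conditional entropy of a point
  given its image; it vanishes iff every fibre of \<open>f\<close> meets the support in at most one
  point.\<close>

lemma entropy_le_pushforward_iff_inj_on: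
  assumes p: "distribution X p" and fY: "f ` supp X p \<subseteq> Y"
    and q: "\<And>y. y \<in> Y \<Longrightarrow> q y = sum p {x \<in> supp X p. f x = y}"
  shows "entropy X p \<le> entropy Y q \<longleftrightarrow> inj_on f (supp X p)"
proof -
  let ?S = "supp X p"
  let ?d = "\<lambda>x. p x * (ln (q (f x)) - ln (p x))"
  have fin: "finite ?S" using p by (simp add: distribution_def subdistribution_def)
  have pos: "\<And>x. x \<in> ?S \<Longrightarrow> p x > 0" using distribution_pos[OF p] .
  \<comment> \<open>Split \<open>x\<close> off its own fibre: the remaining sum is the mass of the
    other points that \<open>f\<close> identifies with \<open>x\<close>.\<close>
  have qf: "q (f x) = p x + sum p ({z \<in> ?S. f z = f x} - {x})" if "x \<in> ?S" for x
    using that fY q fin by (subst q) (auto intro: sum.remove)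
  have le: "p x \<le> q (f x)" if "x \<in> ?S" for x
    using qf[OF that] sum_nonneg[of "{z \<in> ?S. f z = f x} - {x}" p] pos by (force intro: less_imp_le)
  have Hp: "entropy X p = - (\<Sum>x\<in>?S. p x * ln (p x))"
    unfolding entropy_def using fin
    by (intro arg_cong[where f = uminus] sum'_eq_sum) (auto simp: supp_def)
  \<comment> \<open>For a termwise comparison over \<open>?S\<close>, the sum over \<open>Y\<close>
    is spread over the fibres of \<open>f\<close>.\<close>
  have "sum' (\<lambda>y. q y * ln (q y)) Y = (\<Sum>y\<in>f ` ?S. q y * ln (q y))"
  proof (rule sum'_eq_sum)
    fix y assume "y \<in> Y" "q y * ln (q y) \<noteq> 0"
    then have "{x \<in> ?S. f x = y} \<noteq> {}" using q by (metis sum.empty mult_zero_left)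
    then show "y \<in> f ` ?S" by blast
  qed (use fin fY in auto)
  also have "\<dots> = (\<Sum>y\<in>f ` ?S. \<Sum>x\<in>{x \<in> ?S. f x = y}. p x * ln (q (f x)))"
    using fY by (intro sum.cong refl) (auto simp: q sum_distrib_right)
  also have "\<dots> = (\<Sum>x\<in>?S. p x * ln (q (f x)))"
    using fin by (rule sum.image_gen[symmetric])
  finally have diff: "entropy X p - entropy Y q = sum ?d ?S"
    by (simp add: Hp entropy_def[of Y] right_diff_distrib sum_subtractf)
  have nonneg: "?d x \<ge> 0" if "x \<in> ?S" for x
    using pos[OF that] le[OF that] by simp
  have "entropy X p \<le> entropy Y q \<longleftrightarrow> sum ?d ?S = 0"
    using diff sum_nonneg[of ?S ?d] nonneg by force
  also have "\<dots> \<longleftrightarrow> (\<forall>x\<in>?S. ?d x = 0)"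
    using fin nonneg by (intro sum_nonneg_eq_0_iff) auto
  also have "\<dots> \<longleftrightarrow> (\<forall>x\<in>?S. q (f x) = p x)"
  proof (intro ball_cong refl)
    fix x assume "x \<in> ?S"
    \<comment> \<open>Here \<open>q (f x) \<ge> p x > 0\<close>, and \<open>ln\<close> is injective
      on positive reals.\<close>
    then show "?d x = 0 \<longleftrightarrow> q (f x) = p x" using pos[of x] le[of x] by auto
  qed
  also have "\<dots> \<longleftrightarrow> (\<forall>x\<in>?S. \<forall>z\<in>{z \<in> ?S. f z = f x} - {x}. p z = 0)"
  proof (intro ball_cong refl)
    fix x assume x: "x \<in> ?S"
    have "sum p ({z \<in> ?S. f z = f x} - {x}) = 0 \<longleftrightarrow> (\<forall>z\<in>{z \<in> ?S. f z = f x} - {x}. p z = 0)"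
      using fin pos by (intro sum_nonneg_eq_0_iff) (auto intro: less_imp_le)
    then show "q (f x) = p x \<longleftrightarrow> (\<forall>z\<in>{z \<in> ?S. f z = f x} - {x}. p z = 0)"
      using qf[OF x] by simp
  qed
  \<comment> \<open>As \<open>p\<close> is nonzero on \<open>?S\<close>, the condition
    \<open>p z = 0\<close> says that the fibre has no further support point.\<close>
  also have "\<dots> \<longleftrightarrow> inj_on f ?S"
    unfolding inj_on_def supp_def by blast
  finally show ?thesis .
qed

lemma graph_partial_inverse_iff_inj_on:
  fixes f :: "'a \<Rightarrow> 'b" and K :: "'a \<Rightarrow> 'b \<Rightarrow> real"
  assumes fY: "f ` S \<subseteq> Y" and K: "\<And>x y. x \<in> S \<Longrightarrow> y \<in> Y \<Longrightarrow> K x y = of_bool (y = f x)"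
  shows "(\<exists>N. partial_inverse S Y K N) \<longleftrightarrow> inj_on f S"
proof -
  have row: "sum' (K x) Y = 1" if "x \<in> S" for x
    using that fY by (subst sum'_singleton[of "f x"]) (auto simp: K)
  have KN: "mat_mult Y K N x x' = N (f x) x'" if "x \<in> S" for N :: "'b \<Rightarrow> 'a \<Rightarrow> real" and x x'
    unfolding mat_mult_def using that fY by (subst sum'_singleton[of "f x"]) (auto simp: K)
  show ?thesis
  proof
    assume "\<exists>N. partial_inverse S Y K N"
    then obtain N where "mat_eq S S (mat_mult Y K N) (dom_of_def S Y K)"
      by (auto simp: partial_inverse_def)
    \<comment> \<open>Rows of \<open>K\<close> have mass 1, so its domain of definition is the
      identity on \<open>S\<close>. Hence row \<open>f x\<close> of \<open>N\<close> is the unit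
      vector at \<open>x\<close>, and \<open>f x\<close> determines \<open>x\<close>.\<close>
    then have N: "N (f x) x' = of_bool (x = x')" if "x \<in> S" "x' \<in> S" for x x'
      using that by (auto simp: mat_eq_def KN dom_of_def_eq row)
    show "inj_on f S"
    proof (rule inj_onI)
      fix x x' assume "x \<in> S" "x' \<in> S" "f x = f x'"
      then have "of_bool (x = x') = (1 :: real)" using N[of x x'] N[of x' x'] by simp
      then show "x = x'" by simp
    qed
  next
    assume inj: "inj_on f S"
    \<comment> \<open>The transpose of \<open>K\<close>; by injectivity each of its rows holds at
      most one 1.\<close>
    let ?N = "\<lambda>y x. of_bool (y = f x) :: real"
    have N_graph: "?N (f x) x' = of_bool (x' = x)" if "x \<in> S" "x' \<in> S" for x x'
      using inj that by (auto simp: inj_on_def)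
    have N_row: "sum' (?N y) S = of_bool (y \<in> f ` S)" for y
    proof (cases "y \<in> f ` S")
      case True
      then obtain x where "x \<in> S" "y = f x" by blast
      then show ?thesis using N_graph by (subst sum'_singleton[of x]) auto
    qed (use sum'_eq_sum[of "{}" S "?N y"] in auto)
    have "finite (supp S (?N y))" for y
    proof (cases "y \<in> f ` S")
      case True
      then obtain x where "x \<in> S" "y = f x" by blast
      then have "supp S (?N y) \<subseteq> {x}" using inj by (auto simp: supp_def inj_on_def)
      then show ?thesis by (rule finite_subset) simp
    next
      case False
      then have "supp S (?N y) = {}" by (auto simp: supp_def)
      then show ?thesis by simp
    qed
    then have "subdist_matrix Y S ?N"
      by (simp add: subdist_matrix_def subdistribution_def N_row)
    moreover have "mat_eq S S (mat_mult Y K ?N) (dom_of_def S Y K)"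
      using inj by (auto simp: mat_eq_def KN dom_of_def_eq row inj_on_def)
    \<comment> \<open>Both sides are the diagonal matrix marking the image of \<open>f\<close>:
      there \<open>?N\<close> goes to the unique preimage and \<open>K\<close> comes back; elsewhere
      the row of \<open>?N\<close> is zero.\<close>
    moreover have "mat_mult S ?N K y y' = dom_of_def Y S ?N y y'" if "y \<in> Y" "y' \<in> Y" for y y'
    proof (cases "y \<in> f ` S")
      case True
      then obtain x where x: "x \<in> S" "y = f x" by blast
      then have "mat_mult S ?N K y y' = K x y'"
        unfolding mat_mult_def using inj by (subst sum'_singleton[of x]) (auto simp: inj_on_def)
      then show ?thesis using x that True by (auto simp: dom_of_def_eq N_row K)
    next
      case False
      then have "mat_mult S ?N K y y' = 0"
        unfolding mat_mult_def by (subst sum'_eq_sum[of "{}"]) auto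
      then show ?thesis using False that by (auto simp: dom_of_def_eq N_row)
    qed
    ultimately show "\<exists>N. partial_inverse S Y K N"
      by (auto simp: partial_inverse_def mat_eq_def)
  qed
qed

text \<open>Both sides amount to injectivity, on the support of \<open>p\<close>, of the function
  underlying \<open>K\<close>.\<close>

lemma conditionally_reversible_iff_entropy_le:
  assumes K: "computational_transformation X p Y q K" and det: "deterministic X Y K"
  shows "conditionally_reversible X p Y q K \<longleftrightarrow> entropy X p \<le> entropy Y q"
proof -
  obtain f where fY: "f ` supp X p \<subseteq> Y"
    and fK': "\<forall>x\<in>supp X p. \<forall>y\<in>Y. K x y = of_bool (y = f x)"
    and q: "\<forall>y\<in>Y. q y = sum p {x \<in> supp X p. f x = y}"
    using deterministic_transformation_graph[OF K det] .
  have fK: "K x y = of_bool (y = f x)" if "x \<in> supp X p" "y \<in> Y" for x y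
    using fK' that by blast
  have p: "distribution X p" using K by (simp add: computational_transformation_def)
  have "supp X p \<subseteq> mat_supp X Y K"
  proof
    fix x assume x: "x \<in> supp X p"
    then have "K x (f x) = 1" "f x \<in> Y" using fY fK by auto
    then show "x \<in> mat_supp X Y K" using x by (force simp: mat_supp_def supp_def)
  qed
  then show ?thesis
    using K det graph_partial_inverse_iff_inj_on[OF fY fK]
      entropy_le_pushforward_iff_inj_on[OF p fY bspec[OF q]]
    by (simp add: conditionally_reversible_def)
qed

theorem proposition4p27:
  fixes X :: "'a set" and r :: "('a \<times> 'a) set" and p :: "'a \<Rightarrow> real"
    and Y :: "'b set" and s :: "('b \<times> 'b) set" and q :: "'b \<Rightarrow> real"
    and M :: "'a \<Rightarrow> 'b \<Rightarrow> real"
  assumes "physical_transformation X r p Y s q M"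
    and "deterministic (X // r) (Y // s) (quot_mat M)"
  shows "non_entropy_ejecting X r p Y s q M \<longleftrightarrow>
    conditionally_reversible (X // r) (quot_dist p) (Y // s) (quot_dist q) (quot_mat M)"
proof -
  have "entropy X p = entropy Y q"
    using assms(1) by (simp add: physical_transformation_def)
  \<comment> \<open>The physical entropies cancel, and the minus sign of \<open>H_comp\<close> in
    \<open>H_nc\<close> reverses the inequality.\<close>
  then have "non_entropy_ejecting X r p Y s q M \<longleftrightarrow>
      entropy (X // r) (quot_dist p) \<le> entropy (Y // s) (quot_dist q)"
    using assms(1) by (simp add: non_entropy_ejecting_def H_nc_def H_phy_def H_comp_def)
  then show ?thesis
    using conditionally_reversible_iff_entropy_le[OF computational_transformation_quot] assms
    by blast
qed

end
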